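(* The sequence $C_3(n)=c(n,n,n)$ satisfies, for all integers $n\ge 1$, the following linear recurrence equation with polynomial coefficients: $$ \begin{aligned} &72\,(n+2)\left(245n^4+3094n^3+14447n^2+29474n+22100\right)(n+1)^2\,C_3(n)\\ &-(n+2)\left(21805n^6+330981n^5+2012733n^4+6230951n^3+10263446n^2+8425060n+2639760\right)C_3(n+1)\\ &+\left(-13230n^7-249641n^6-1998705n^5-8785333n^4-22847777n^3-35069178n^2-29331496n-10279296\right)C_3(n+2)\\ &+\left(21560n^7+413637n^6+3343917n^5+14735333n^4+38132651n^3+57777574n^2+47273504n+16026528\right)C_3(n+3)\\ &-(n+4)\left(4410n^6+70147n^5+452903n^4+1516515n^3+2769127n^2+2601986n+975888\right)C_3(n+4)\\ &+(n+5)(n+4)(n+3)\left(245n^4+2114n^3+6635n^2+8882n+4224\right)C_3(n+5)=0, \end{aligned} $$ subject to the initial conditions $$ C_3(1)=1,\quad C_3(2)=6,\quad C_3(3)=37,\quad C_3(4)=240,\quad C_3(5)=1621. $$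
   Context: For positive integers $m_1,m_2,m_3$, the number $c(m_1,m_2,m_3)$ is defined as the coefficient of $t_1^{m_1-1}t_2^{m_2-1}t_3^{m_3-1}$ in the polynomial $$ \prod_{i=1}^{3}\frac{\hat{t_i}^{\,m_i}-t_i^{m_i}}{\hat{t_i}-t_i},\qquad \hat{t_i}=(t_1+t_2+t_3)-t_i , $$ where each factor is understood as the polynomial $\sum_{k=0}^{m_i-1}\hat{t_i}^{\,k}\,t_i^{\,m_i-1-k}$. For $n\ge 1$, $C_3(n):=c(n,n,n)$. (By a theorem of Friedland and Ottaviani, this is the number of simple singular vector tuples of a generic $n\times n\times n$ tensor; the coefficient is taken as the definition here.) *)

theory Defs
  imports Complex_Main "HOL-Library.Poly_Mapping"
begin

(* Multivariate integer polynomials as finitely supported maps from exponent vectors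
   (nat \<Rightarrow>\<^sub>0 nat, variable index to exponent) to coefficients; multiplication is the
   convolution product of Poly_Mapping. Only the variables with index 1, 2, 3 are used. *)
type_synonym ipoly = "(nat \<Rightarrow>\<^sub>0 nat) \<Rightarrow>\<^sub>0 int"

definition tvar :: "nat \<Rightarrow> ipoly" where
  "tvar i = Poly_Mapping.single (Poly_Mapping.single i 1) 1"

definition tvar_hat :: "nat \<Rightarrow> ipoly" where
  "tvar_hat i = (tvar 1 + tvar 2 + tvar 3) - tvar i"

(* The polynomial quotient (tvar_hat i ^ m - tvar i ^ m) / (tvar_hat i - tvar i). *)
definition factor :: "nat \<Rightarrow> nat \<Rightarrow> ipoly" where
  "factor m i = (\<Sum>k<m. tvar_hat i ^ k * tvar i ^ (m - 1 - k))"

lemma factor_quotient: "(tvar_hat i - tvar i) * factor m i = tvar_hat i ^ m - tvar i ^ m"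
proof -
  have "(tvar_hat i - tvar i) * (\<Sum>k<m. tvar i ^ (m - Suc k) * tvar_hat i ^ k) = tvar_hat i ^ m - tvar i ^ m"
    by (rule power_diff_sumr2 [symmetric])
  thus ?thesis by (simp add: factor_def mult.commute)
qed

(* Meaningful for positive arguments only (natural-number subtraction truncates). *)
definition c :: "nat \<Rightarrow> nat \<Rightarrow> nat \<Rightarrow> int" where
  "c m1 m2 m3 =
     Poly_Mapping.lookup (factor m1 1 * factor m2 2 * factor m3 3)
       (Poly_Mapping.single 1 (m1 - 1) + Poly_Mapping.single 2 (m2 - 1)
          + Poly_Mapping.single 3 (m3 - 1))"

definition C3 :: "nat \<Rightarrow> int" where
  "C3 n = c n n n"

end

theory Submission
  imports Defs
begin

text \<open>
  Write \<open>x, y, z\<close> for the variables and \<open>u, v, w\<close> for their hats divided by them, so that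
  \<open>u = (y + z) / x\<close> and so on. The three factors are geometric sums, hence \<open>C3 n\<close> is the sum over the
  cube \<open>i, j, k < n\<close> of \<open>D i j k\<close>, the constant term of \<open>u^i v^j w^k\<close> (\<open>C3_eq_sum_D\<close>). The
  identity \<open>u v w = u + v + w + 2\<close> turns into a recursion for \<open>D\<close>, which says that \<open>D\<close> has the
  generating function \<open>1 / Q\<close> with \<open>Q = 1 - (x y + x z + y z) - 2 x y z\<close>; this is an instance of
  MacMahon's master theorem. Everything else follows from this recursion.

  The cube sum has the generating function \<open>1 / ((1 - x) (1 - y) (1 - z) Q)\<close>. At \<open>x = y = z = 1\<close> the
  polynomial \<open>Q\<close> is the nonzero constant \<open>-4\<close>, and at \<open>y = z = 1\<close> it is the monomial \<open>-4 x\<close>. Both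
  facts allow a pole to be cancelled: cube sums reduce to square sums, and square sums to line sums.
  On the diagonal the outcome is \<open>4 C3(n) + 1 = 3 a(n) - 2 f(n)\<close>, where \<open>f(n) = D n n n\<close> is the
  \<open>n\<close>-th Franel number and \<open>a(n)\<close> is the sum of \<open>D n n k\<close> over \<open>k \<le> n\<close>
  (\<open>C3_eq_diag_line\<close>).

  A vector field that annihilates \<open>Q\<close> gives a contiguity relation between neighbouring
  coefficients (\<open>D_contiguous\<close>). On the diagonal it yields the classical recurrence of order two for
  \<open>f\<close>. Its sum over \<open>k\<close> telescopes, and this gives for \<open>a\<close> the recurrence of order two
  of the central coefficients of \<open>1 / (1 - x - y - 3 x y)\<close>, with an inhomogeneous
  term in \<open>f(n)\<close> and \<open>f(n + 1)\<close>. The recurrence for \<open>C3\<close> is a linear consequence of these two: its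
  operator kills constants, and applied to \<open>3 a - 2 f\<close> it is an explicit combination of shifts
  of the two recurrences.
\<close>

section \<open>Coefficients of monomial multiples\<close>

lemma lookup_monomial_times:
  fixes p :: "'a::cancel_comm_monoid_add \<Rightarrow>\<^sub>0 int"
  shows "Poly_Mapping.lookup (Poly_Mapping.single m 1 * p) (m + e) = Poly_Mapping.lookup p e"
  unfolding lookup_mult lookup_single when_mult by simp

lemma lookup_monomial_times_eq_0:
  fixes p :: "'a::cancel_comm_monoid_add \<Rightarrow>\<^sub>0 int"
  assumes "\<And>q. e \<noteq> m + q"
  shows "Poly_Mapping.lookup (Poly_Mapping.single m 1 * p) e = 0"
  unfolding lookup_mult lookup_single when_mult by (simp add: assms)

lemma lookup_monomial: "Poly_Mapping.lookup (Poly_Mapping.single m 1) e = (of_bool (m = e) :: int)"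
  by (simp add: lookup_single when_def)

definition expo :: "nat \<Rightarrow> nat \<Rightarrow> nat \<Rightarrow> nat \<Rightarrow>\<^sub>0 nat" where
  "expo i j k = Poly_Mapping.single 1 i + Poly_Mapping.single 2 j + Poly_Mapping.single 3 k"

lemma lookup_expo:
  "Poly_Mapping.lookup (expo i j k) 1 = i"
  "Poly_Mapping.lookup (expo i j k) 2 = j"
  "Poly_Mapping.lookup (expo i j k) 3 = k"
  by (simp_all add: expo_def lookup_add lookup_single)

lemma expo_inject: "expo i j k = expo i' j' k' \<longleftrightarrow> i = i' \<and> j = j' \<and> k = k'"
  by (metis lookup_expo)

lemma expo_add: "expo i j k + expo i' j' k' = expo (i + i') (j + j') (k + k')"
  by (simp add: expo_def single_add algebra_simps)

lemma tvar_power: "tvar i ^ n = Poly_Mapping.single (Poly_Mapping.single i n) 1"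
  by (induction n) (simp_all add: tvar_def mult_single flip: single_add)

lemma tvar_monomial:
  "tvar 1 ^ i * tvar 2 ^ j * tvar 3 ^ k = Poly_Mapping.single (expo i j k) 1"
  by (simp add: tvar_power mult_single expo_def)

lemma tvar_hat_simps:
  "tvar_hat 1 = tvar 2 + tvar 3" "tvar_hat 2 = tvar 1 + tvar 3" "tvar_hat 3 = tvar 1 + tvar 2"
  by (simp_all add: tvar_hat_def)

section \<open>The coefficients of the master theorem\<close>

definition hat_monomial :: "nat \<Rightarrow> nat \<Rightarrow> nat \<Rightarrow> ipoly" where
  "hat_monomial i j k = tvar_hat 1 ^ i * tvar_hat 2 ^ j * tvar_hat 3 ^ k"

text \<open>
  The diagonal coefficient of \<open>hat_monomial\<close>, given by its recursion (\<open>lookup_hat_monomial\<close>).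
  If one index is \<open>0\<close>, only one monomial can contribute, which explains the boundary values.
\<close>

fun D :: "nat \<Rightarrow> nat \<Rightarrow> nat \<Rightarrow> int" where
  "D i j 0 = of_bool (i = j)"
| "D i 0 (Suc k) = of_bool (i = Suc k)"
| "D 0 (Suc j) (Suc k) = of_bool (j = k)"
| "D (Suc i) (Suc j) (Suc k) = D (Suc i) j k + D i (Suc j) k + D i j (Suc k) + 2 * D i j k"

text \<open>This is \<open>u v w = u + v + w + 2\<close> with the denominators cleared.\<close>

lemma hat_product:
  "tvar_hat 1 * tvar_hat 2 * tvar_hat 3 =
     tvar 2 * tvar 3 * tvar_hat 1 + tvar 1 * tvar 3 * tvar_hat 2 + tvar 1 * tvar 2 * tvar_hat 3
     + 2 * (tvar 1 * tvar 2 * tvar 3)"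
  unfolding tvar_hat_simps by (simp add: algebra_simps)

text \<open>
  A coefficient of a monomial without the variable \<open>v\<close> does not change when \<open>v\<close> is set to \<open>0\<close>. Doing
  so reduces each hat to a single variable, which settles the boundary values of \<open>D\<close>.
\<close>

lemma lookup_absent_variable_step:
  assumes "Poly_Mapping.lookup e v = 0"
  shows "Poly_Mapping.lookup ((tvar w + tvar v) * p) e = Poly_Mapping.lookup (tvar w * p) e"
proof -
  have "e \<noteq> Poly_Mapping.single v 1 + q" for q
    using assms by (auto simp: lookup_add)
  hence "Poly_Mapping.lookup (tvar v * p) e = 0"
    unfolding tvar_def by (rule lookup_monomial_times_eq_0)
  thus ?thesis by (simp add: distrib_right lookup_add)
qed

lemma lookup_absent_variable:
  assumes "Poly_Mapping.lookup e v = 0"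
  shows "Poly_Mapping.lookup ((tvar w + tvar v) ^ n * p) e = Poly_Mapping.lookup (tvar w ^ n * p) e"
proof (induction n arbitrary: p)
  case (Suc n)
  have "Poly_Mapping.lookup ((tvar w + tvar v) ^ Suc n * p) e =
      Poly_Mapping.lookup (tvar w * ((tvar w + tvar v) ^ n * p)) e"
    using lookup_absent_variable_step[OF assms] by (simp add: mult.assoc)
  also have "\<dots> = Poly_Mapping.lookup ((tvar w + tvar v) ^ n * (tvar w * p)) e"
    by (simp add: mult_ac)
  also have "\<dots> = Poly_Mapping.lookup (tvar w ^ Suc n * p) e"
    unfolding Suc by (simp only: power_Suc mult_ac)
  finally show ?case .
qed simp

lemma lookup_two_hats:
  assumes "Poly_Mapping.lookup e v = 0"
  shows "Poly_Mapping.lookup ((tvar w + tvar v) ^ m * (tvar u + tvar v) ^ n) e =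
    Poly_Mapping.lookup (tvar w ^ m * tvar u ^ n) e"
  using lookup_absent_variable[OF assms, of w m "(tvar u + tvar v) ^ n"]
    lookup_absent_variable[OF assms, of u n "tvar w ^ m"]
  by (simp add: mult.commute)

lemma lookup_hat_monomial:
  "Poly_Mapping.lookup (hat_monomial i j k) (expo i j k) = D i j k"
proof (induction i j k rule: D.induct)
  case (1 i j)
  have "Poly_Mapping.lookup (hat_monomial i j 0) (expo i j 0) =
      Poly_Mapping.lookup (tvar 2 ^ i * tvar 1 ^ j) (expo i j 0)"
    unfolding hat_monomial_def tvar_hat_simps power_0 mult_1_right
    by (rule lookup_two_hats) (rule lookup_expo)
  also have "tvar 2 ^ i * tvar 1 ^ j = Poly_Mapping.single (expo j i 0) 1"
    using tvar_monomial[of j i 0] by (simp add: mult.commute)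
  finally show ?case
    by (simp only: lookup_monomial expo_inject D.simps) auto
next
  case (2 i k)
  have "Poly_Mapping.lookup (hat_monomial i 0 (Suc k)) (expo i 0 (Suc k)) =
      Poly_Mapping.lookup ((tvar 3 + tvar 2) ^ i * (tvar 1 + tvar 2) ^ Suc k) (expo i 0 (Suc k))"
    unfolding hat_monomial_def tvar_hat_simps power_0 mult_1_right by (simp add: add.commute)
  also have "\<dots> = Poly_Mapping.lookup (tvar 3 ^ i * tvar 1 ^ Suc k) (expo i 0 (Suc k))"
    by (rule lookup_two_hats) (rule lookup_expo)
  also have "tvar 3 ^ i * tvar 1 ^ Suc k = Poly_Mapping.single (expo (Suc k) 0 i) 1"
    using tvar_monomial[of "Suc k" 0 i] by (simp add: mult.commute)
  finally show ?case
    by (simp only: lookup_monomial expo_inject D.simps) auto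
next
  case (3 j k)
  have "Poly_Mapping.lookup (hat_monomial 0 (Suc j) (Suc k)) (expo 0 (Suc j) (Suc k)) =
      Poly_Mapping.lookup ((tvar 3 + tvar 1) ^ Suc j * (tvar 2 + tvar 1) ^ Suc k) (expo 0 (Suc j) (Suc k))"
    unfolding hat_monomial_def tvar_hat_simps power_0 mult_1_left by (simp add: add.commute)
  also have "\<dots> = Poly_Mapping.lookup (tvar 3 ^ Suc j * tvar 2 ^ Suc k) (expo 0 (Suc j) (Suc k))"
    by (rule lookup_two_hats) (rule lookup_expo)
  also have "tvar 3 ^ Suc j * tvar 2 ^ Suc k = Poly_Mapping.single (expo 0 (Suc k) (Suc j)) 1"
    using tvar_monomial[of 0 "Suc k" "Suc j"] by (simp add: mult.commute)
  finally show ?case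
    by (simp only: lookup_monomial expo_inject D.simps) auto
next
  case (4 i j k)
  let ?P = "hat_monomial" and ?m = "\<lambda>i j k. Poly_Mapping.single (expo i j k) (1::int)"
  have "?P (Suc i) (Suc j) (Suc k) = tvar_hat 1 * tvar_hat 2 * tvar_hat 3 * ?P i j k"
    by (simp add: hat_monomial_def mult_ac)
  also have "\<dots> = (tvar 2 * tvar 3) * (tvar_hat 1 * ?P i j k)
      + (tvar 1 * tvar 3) * (tvar_hat 2 * ?P i j k) + (tvar 1 * tvar 2) * (tvar_hat 3 * ?P i j k)
      + ((tvar 1 * tvar 2 * tvar 3) * ?P i j k + (tvar 1 * tvar 2 * tvar 3) * ?P i j k)"
    unfolding hat_product by (simp add: algebra_simps)
  also have "\<dots> = ?m 0 1 1 * ?P (Suc i) j k + ?m 1 0 1 * ?P i (Suc j) k + ?m 1 1 0 * ?P i j (Suc k)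
      + (?m 1 1 1 * ?P i j k + ?m 1 1 1 * ?P i j k)"
    by (simp add: hat_monomial_def mult_ac flip: tvar_monomial)
  finally have P: "?P (Suc i) (Suc j) (Suc k) = \<dots>" .
  have e: "expo (Suc i) (Suc j) (Suc k) = expo 0 1 1 + expo (Suc i) j k"
    "expo (Suc i) (Suc j) (Suc k) = expo 1 0 1 + expo i (Suc j) k"
    "expo (Suc i) (Suc j) (Suc k) = expo 1 1 0 + expo i j (Suc k)"
    "expo (Suc i) (Suc j) (Suc k) = expo 1 1 1 + expo i j k"
    by (simp_all add: expo_add)
  have "Poly_Mapping.lookup (?m 0 1 1 * ?P (Suc i) j k) (expo (Suc i) (Suc j) (Suc k)) = D (Suc i) j k"
    unfolding e(1) lookup_monomial_times by (rule 4)
  moreover have "Poly_Mapping.lookup (?m 1 0 1 * ?P i (Suc j) k) (expo (Suc i) (Suc j) (Suc k)) = D i (Suc j) k"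
    unfolding e(2) lookup_monomial_times by (rule 4)
  moreover have "Poly_Mapping.lookup (?m 1 1 0 * ?P i j (Suc k)) (expo (Suc i) (Suc j) (Suc k)) = D i j (Suc k)"
    unfolding e(3) lookup_monomial_times by (rule 4)
  moreover have "Poly_Mapping.lookup (?m 1 1 1 * ?P i j k) (expo (Suc i) (Suc j) (Suc k)) = D i j k"
    unfolding e(4) lookup_monomial_times by (rule 4)
  ultimately show ?case
    unfolding P lookup_add by simp
qed

text \<open>
  The term of the product with indices \<open>i, j, k\<close> is \<open>hat_monomial i j k\<close> times the monomial with
  the exponents \<open>n - 1 - i\<close>, \<open>n - 1 - j\<close> and \<open>n - 1 - k\<close>; removing that monomial from the target
  exponent leaves exactly \<open>expo i j k\<close>.
\<close>

lemma C3_eq_sum_D: "C3 n = (\<Sum>i<n. \<Sum>j<n. \<Sum>k<n. D i j k)"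
proof -
  let ?e = "expo (n - 1) (n - 1) (n - 1)"
  define s where "s v i = tvar_hat v ^ i * tvar v ^ (n - 1 - i)" for v i
  have coeff: "Poly_Mapping.lookup (s 1 i * s 2 j * s 3 k) ?e = D i j k"
    if "i < n" "j < n" "k < n" for i j k
  proof -
    have "s 1 i * s 2 j * s 3 k =
        (tvar 1 ^ (n - 1 - i) * tvar 2 ^ (n - 1 - j) * tvar 3 ^ (n - 1 - k)) * hat_monomial i j k"
      unfolding s_def hat_monomial_def by (simp only: mult_ac)
    moreover have "?e = expo (n - 1 - i) (n - 1 - j) (n - 1 - k) + expo i j k"
      using that by (simp add: expo_add)
    ultimately show ?thesis
      by (simp only: tvar_monomial lookup_monomial_times lookup_hat_monomial)
  qed
  have "factor n 1 * factor n 2 * factor n 3 = (\<Sum>i<n. \<Sum>j<n. \<Sum>k<n. s 1 i * s 2 j * s 3 k)"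
    unfolding factor_def s_def[symmetric] by (simp only: flip: sum_distrib_left sum_distrib_right)
  moreover have "C3 n = Poly_Mapping.lookup (factor n 1 * factor n 2 * factor n 3) ?e"
    by (simp add: C3_def c_def expo_def)
  ultimately show ?thesis
    by (simp only: lookup_sum) (intro sum.cong refl, simp only: lessThan_iff coeff)
qed

lemma D_swap12: "D i j k = D j i k"
proof (induction i j k rule: D.induct)
  case (2 i k) show ?case by (cases i) auto
qed auto

lemma D_swap23: "D i j k = D i k j"
proof (induction i j k rule: D.induct)
  case (1 i j) show ?case by (cases j) auto
next
  case (3 j k) show ?case by auto
qed auto

lemma D_axis: "D i 0 k = of_bool (i = k)"
  by (cases k) auto

lemma D_1: "D i j 1 = (if j = i + 1 then int j else if i = j + 1 then int i else if i = j then 2 * int i else 0)"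
proof (induction i arbitrary: j)
  case 0 show ?case by (cases j) auto
next
  case (Suc i)
  show ?case by (cases j) (use Suc in auto)
qed

text \<open>
  The vector field \<open>z ((1 + 2 x) \<partial>\<^sub>x - (1 + 2 y) \<partial>\<^sub>y) + x \<partial>\<^sub>x - y \<partial>\<^sub>y\<close> annihilates \<open>Q\<close>, hence also \<open>1 / Q\<close>;
  the relation compares coefficients of \<open>x^i y^j z^(k + 1)\<close>. In the induction this appears as the fact
  that the left-hand side satisfies the same recursion as \<open>D\<close>.
\<close>

lemma D_contiguous:
  "(int i + 1) * D (Suc i) j k - (int j + 1) * D i (Suc j) k
     + (int i - int j) * (2 * D i j k + D i j (Suc k)) = 0"
proof (induction i j k rule: D.induct)
  case (1 i j) show ?case using D_1[of i j] by auto
next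
  case (2 i k)
  show ?case using D_1[of i "Suc k"] D_swap23[of i 1 "Suc k"] by auto
next
  case (3 j k)
  show ?case using D_1[of "Suc j" "Suc k"] D_swap12[of 1 "Suc j" "Suc k"] D_swap23[of "Suc j" 1 "Suc k"] by auto
next
  case (4 i j k)
  show ?case using 4 by (simp, algebra)
qed

section \<open>Line sums and box sums\<close>

text \<open>
  The upper bounds are strict, so that an empty range gives the boundary value \<open>0\<close> in the
  recursions below.
\<close>

definition line_sum :: "nat \<Rightarrow> nat \<Rightarrow> nat \<Rightarrow> int" where
  "line_sum i j r = (\<Sum>k<r. D i j k)"

definition square_sum :: "nat \<Rightarrow> nat \<Rightarrow> nat \<Rightarrow> int" where
  "square_sum i q r = (\<Sum>j<q. line_sum i j r)"

definition box_sum :: "nat \<Rightarrow> nat \<Rightarrow> nat \<Rightarrow> int" where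
  "box_sum p q r = (\<Sum>i<p. square_sum i q r)"

lemma sum_first [simp]: "line_sum i j 0 = 0" "square_sum i 0 r = 0" "box_sum 0 q r = 0"
  by (simp_all add: line_sum_def square_sum_def box_sum_def)

lemma sum_step:
  "line_sum i j (Suc r) = line_sum i j r + D i j r" "square_sum i (Suc q) r = square_sum i q r + line_sum i q r"
  "box_sum (Suc p) q r = box_sum p q r + square_sum p q r"
  by (simp_all add: line_sum_def square_sum_def box_sum_def)

lemma line_sum_swap: "line_sum i j r = line_sum j i r"
  unfolding line_sum_def by (rule sum.cong[OF refl]) (rule D_swap12)

lemma square_sum_swap: "square_sum i q r = square_sum i r q"
  unfolding square_sum_def line_sum_def by (subst sum.swap, intro sum.cong refl) (rule D_swap23)

lemma box_sum_swap12: "box_sum p q r = box_sum q p r"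
  unfolding box_sum_def square_sum_def by (subst sum.swap, intro sum.cong refl) (rule line_sum_swap)

lemma box_sum_swap23: "box_sum p q r = box_sum p r q"
  unfolding box_sum_def by (rule sum.cong[OF refl]) (rule square_sum_swap)

lemma line_sum_axis: "line_sum i 0 r = of_bool (i < r)"
proof (induction r)
  case (Suc r)
  thus ?case using D_axis[of i r] by (auto simp: sum_step)
qed simp

text \<open>
  Summation in one direction multiplies the generating function by \<open>1 / (1 - z)\<close> and so preserves the
  recursion, except for what the boundary values contribute. This contribution is \<open>0\<close> for lines and
  squares, and \<open>1\<close> for boxes.
\<close>

lemma line_sum_rec:
  "line_sum (Suc i) (Suc j) (Suc r) = line_sum (Suc i) j r + line_sum i (Suc j) r + line_sum i j (Suc r) + 2 * line_sum i j r"
  by (induction r) (simp_all add: sum_step)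

lemma square_sum_rec:
  "square_sum (Suc i) (Suc q) (Suc r) = square_sum (Suc i) q r + square_sum i (Suc q) r + square_sum i q (Suc r) + 2 * square_sum i q r"
proof (induction q)
  case 0 show ?case by (simp add: sum_step(2) line_sum_axis)
next
  case (Suc q)
  show ?case using Suc line_sum_rec[of i q r] by (simp add: sum_step(2))
qed

lemma square_sum_axis: "square_sum 0 q r = int (min q r)"
proof (induction q)
  case (Suc q)
  have "line_sum 0 q r = of_bool (q < r)" by (metis line_sum_axis line_sum_swap)
  with Suc show ?case by (auto simp: sum_step)
qed simp

lemma box_sum_rec:
  "box_sum (Suc p) (Suc q) (Suc r) = 1 + box_sum (Suc p) q r + box_sum p (Suc q) r + box_sum p q (Suc r) + 2 * box_sum p q r"
proof (induction p)
  case 0 show ?case by (simp add: sum_step(3) square_sum_axis)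
next
  case (Suc p)
  show ?case using Suc square_sum_rec[of p q r] by (simp add: sum_step(3))
qed

lemma C3_eq_box_sum: "C3 n = box_sum n n n"
  by (simp add: C3_eq_sum_D box_sum_def square_sum_def line_sum_def)

text \<open>
  In the sum of \<open>D_contiguous\<close> over \<open>k\<close>, the terms \<open>D i j (Suc k)\<close> add up to another
  copy of the line sum and a boundary term.
\<close>

lemma line_sum_contiguous:
  "(int i + 1) * line_sum (Suc i) j r - (int j + 1) * line_sum i (Suc j) r + 3 * (int i - int j) * line_sum i j r
     = (int j - int i) * D i j r"
proof (induction r)
  case (Suc r)
  show ?case using Suc D_contiguous[of i j r] unfolding sum_step by algebra
qed auto

section \<open>Recurrences on the diagonal\<close>

text \<open>
  The coefficients one and two steps off the diagonal. Together with the diagonal they form a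
  system of order one, and \<open>near2_eq\<close> shows that it has rank two.
\<close>

definition franel :: "nat \<Rightarrow> int" where "franel n = D n n n"
definition near1 :: "nat \<Rightarrow> int" where "near1 n = D (Suc n) n n"
definition near2 :: "nat \<Rightarrow> int" where "near2 n = D (Suc n) (Suc n) n"

lemma near_perms:
  "D n (Suc n) n = near1 n" "D n n (Suc n) = near1 n"
  "D (Suc n) n (Suc n) = near2 n" "D n (Suc n) (Suc n) = near2 n"
  unfolding near1_def near2_def by (metis D_swap12 D_swap23)+

lemma franel_Suc: "franel (Suc n) = 3 * near1 n + 2 * franel n"
  unfolding franel_def by (simp add: near_perms flip: near1_def)

text \<open>Coefficients farther from the diagonal are brought back to it by \<open>D_contiguous\<close>.\<close>

lemma D_two_steps: "(int n + 2) * D (Suc (Suc n)) n n = int n * near2 n - 2 * near1 n"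
  using D_contiguous[of "Suc n" n n] by (simp add: near_perms algebra_simps flip: near1_def near2_def)

lemma near1_Suc_expand: "near1 (Suc n) = D (Suc (Suc n)) n n + 2 * near2 n + 2 * near1 n"
  unfolding near1_def near2_def by (subst D.simps(4)) (simp only: D_swap23[of "Suc n" n "Suc n"])

lemma near1_Suc: "(int n + 2) * near1 (Suc n) = (3 * int n + 4) * near2 n + 2 * (int n + 1) * near1 n"
  using D_two_steps[of n] near1_Suc_expand[of n] by algebra

lemma near2_Suc: "(int n + 3) * near2 (Suc n) = (3 * int n + 5) * franel (Suc n) + 2 * (int n + 1) * near2 n"
proof -
  let ?x = "D (Suc (Suc n)) (Suc n) n"
  have eqs: "D (Suc (Suc n)) n (Suc n) = ?x" "D (Suc n) n (Suc (Suc n)) = ?x"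
    "D (Suc n) (Suc (Suc n)) n = ?x"
    by (metis D_swap12 D_swap23)+
  have "(int n + 3) * ?x = (int n + 1) * franel (Suc n) - 2 * near2 n"
    using D_contiguous[of "Suc n" n "Suc n"] unfolding eqs near_perms franel_def by (simp add: algebra_simps del: D.simps)
  moreover have "near2 (Suc n) = 2 * ?x + franel (Suc n) + 2 * near2 n"
    unfolding near2_def franel_def by (subst D.simps(4)) (simp only: eqs)
  ultimately show ?thesis by algebra
qed

text \<open>
  The linear form \<open>(n + 2) near2 n - (n + 1) (near1 n + 2 franel n)\<close> vanishes at \<open>n = 0\<close>, and the
  system maps it to a multiple of itself.
\<close>

lemma near2_eq: "(int n + 2) * near2 n = (int n + 1) * (near1 n + 2 * franel n)"
proof (induction n)
  case 0 show ?case by (simp add: franel_def near1_def near2_def)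
next
  case (Suc n)
  show ?case using Suc near2_Suc[of n] near1_Suc[of n] franel_Suc[of n] by (simp, algebra)
qed

lemma franel_recurrence:
  "(int n + 2)^2 * franel (n + 2) = (7 * int n^2 + 21 * int n + 16) * franel (n + 1) + 8 * (int n + 1)^2 * franel n"
  using franel_Suc[of "Suc n"] franel_Suc[of n] near1_Suc[of n] near2_eq[of n] by (simp, algebra)

definition diag_line :: "nat \<Rightarrow> int" where "diag_line n = line_sum n n (Suc n)"
definition near_line :: "nat \<Rightarrow> int" where "near_line n = line_sum (Suc n) n (Suc n)"

text \<open>
  Moving all line sums to the same upper bound turns \<open>Q\<close> into its value \<open>1 - x - y - 3 x y\<close> at \<open>z = 1\<close>,
  up to terms in \<open>D\<close>.
\<close>

lemma line_sum_rec_level: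
  "line_sum (Suc i) (Suc j) (Suc r) =
     line_sum (Suc i) j (Suc r) + line_sum i (Suc j) (Suc r) + 3 * line_sum i j (Suc r)
     - D (Suc i) j r - D i (Suc j) r - 2 * D i j r"
  using line_sum_rec[of i j r] sum_step(1) by simp

lemma line_sum_corner:
  "line_sum (Suc n) (Suc n) (Suc n) =
     2 * near_line n + 3 * diag_line n - 2 * near1 n - 2 * franel n"
  using line_sum_rec_level[of n n n] line_sum_swap[of n "Suc n" "Suc n"] near_perms(1)[of n]
  unfolding near_line_def diag_line_def near1_def franel_def by linarith

lemma diag_line_Suc: "diag_line (Suc n) = 2 * near_line n + 3 * diag_line n + near1 n"
proof -
  have "diag_line (Suc n) = line_sum (Suc n) (Suc n) (Suc n) + franel (Suc n)"
    unfolding diag_line_def franel_def by (rule sum_step)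
  thus ?thesis using line_sum_corner[of n] franel_Suc[of n] by linarith
qed

lemma near_line_Suc:
  "(int n + 2) * near_line (Suc n) =
     (2 * int n + 3) * (diag_line (Suc n) - franel (Suc n))
     + (int n + 1) * (3 * near_line n + near2 n)"
proof -
  let ?x = "line_sum (Suc (Suc n)) n (Suc n)"
  let ?c = "line_sum (Suc n) (Suc n) (Suc n)"
  have "(int n + 2) * ?x = (int n + 1) * ?c - 3 * near_line n - near2 n"
    using line_sum_contiguous[of "Suc n" n "Suc n"] near_perms(3)[of n]
    unfolding near_line_def by (simp add: algebra_simps del: D.simps)
  moreover have "near_line (Suc n) = ?x + ?c + 3 * near_line n + near2 n"
    using line_sum_rec_level[of "Suc n" n n] near1_Suc_expand[of n]
      sum_step(1)[of "Suc (Suc n)" "Suc n" "Suc n"]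
    unfolding near_line_def near1_def near2_def by linarith
  moreover have "?c = diag_line (Suc n) - franel (Suc n)"
    unfolding diag_line_def franel_def by (simp add: sum_step(1) del: D.simps)
  ultimately show ?thesis by algebra
qed

lemma diag_line_recurrence:
  "3 * (int n + 2) * ((int n + 2) * diag_line (n + 2) - 5 * (2 * int n + 3) * diag_line (n + 1)
       + 9 * (int n + 1) * diag_line n)
     = 2 * (int n + 1) * (11 * int n + 14) * franel n
       - 2 * (4 * int n^2 + 17 * int n + 16) * franel (n + 1)"
  using diag_line_Suc[of n] diag_line_Suc[of "Suc n"] near_line_Suc[of n]
    near1_Suc[of n] near2_eq[of n] franel_Suc[of n]
  by (simp, algebra)

section \<open>The cube sum and the elimination\<close>

text \<open>
  The recursion for boxes at the corner of the cube, with the neighbouring boxes written as the cube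
  minus faces, loses the pole at \<open>(1, 1, 1)\<close> and expresses the cube by a face. The recursion for
  squares with \<open>i = Suc m\<close> does the same for that face: there \<open>Q = -4 x\<close>, so the face at level \<open>m\<close> is
  expressed by edges at the levels \<open>m\<close> and \<open>Suc m\<close>. By \<open>diag_line_Suc\<close> and \<open>franel_Suc\<close> the edges
  combine into values at \<open>Suc m\<close> alone.
\<close>

lemma C3_eq_diag_line: "4 * C3 n + 1 = 3 * diag_line n - 2 * franel n"
proof (cases n)
  case 0 thus ?thesis by (simp add: C3_eq_box_sum diag_line_def franel_def sum_step)
next
  case (Suc m)
  let ?m = "Suc m"
  have box: "box_sum ?m ?m ?m = 1 + 3 * box_sum ?m m m + 2 * box_sum m m m"
    using box_sum_rec[of m m m] box_sum_swap12[of m ?m m] box_sum_swap23[of m m ?m] by linarith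
  have "box_sum ?m ?m ?m = box_sum ?m m m + square_sum m m ?m + square_sum m ?m ?m"
    using sum_step(3)[of m ?m ?m] sum_step(3)[of m m ?m] box_sum_swap12[of m ?m ?m]
      box_sum_swap12[of m ?m m] box_sum_swap23[of m m ?m] by linarith
  moreover have "box_sum ?m m m = box_sum m m m + square_sum m m m"
    by (rule sum_step)
  moreover have "square_sum m ?m ?m = square_sum m m ?m + diag_line m"
    unfolding diag_line_def by (rule sum_step)
  moreover have "square_sum m m ?m = square_sum m m m + line_sum m m m"
    using sum_step(2)[of m m m] square_sum_swap[of m m ?m] by linarith
  moreover have "diag_line m = line_sum m m m + franel m"
    unfolding diag_line_def franel_def by (rule sum_step)
  ultimately have cube: "4 * box_sum ?m ?m ?m = 12 * square_sum m ?m ?m - 9 * diag_line m + 2 * franel m - 1"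
    and square: "square_sum m ?m m + square_sum m m ?m + 2 * square_sum m m m =
      4 * square_sum m ?m ?m - 6 * diag_line m + 2 * franel m"
    using box square_sum_swap[of m m ?m] by linarith+
  have "square_sum ?m ?m ?m = square_sum ?m m m + line_sum ?m m m + near_line m"
    using sum_step(2)[of ?m m ?m] sum_step(2)[of ?m m m] square_sum_swap[of ?m m ?m]
    unfolding near_line_def by linarith
  moreover have "near_line m = line_sum ?m m m + near1 m"
    unfolding near_line_def near1_def by (rule sum_step)
  ultimately have "4 * square_sum m ?m ?m = 2 * near_line m - near1 m + 6 * diag_line m - 2 * franel m"
    using square_sum_rec[of m m m] square by linarith
  thus ?thesis
    using cube diag_line_Suc[of m] franel_Suc[of m] unfolding Suc C3_eq_box_sum by linarith
qed

definition rec_op :: "(nat \<Rightarrow> int) \<Rightarrow> nat \<Rightarrow> int" where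
  "rec_op y n =
      72 * (int n + 2) * (245 * int n^4 + 3094 * int n^3 + 14447 * int n^2 + 29474 * int n + 22100) * (int n + 1)^2 * y n
    - (int n + 2) * (21805 * int n^6 + 330981 * int n^5 + 2012733 * int n^4 + 6230951 * int n^3
        + 10263446 * int n^2 + 8425060 * int n + 2639760) * y (n + 1)
    + (- 13230 * int n^7 - 249641 * int n^6 - 1998705 * int n^5 - 8785333 * int n^4 - 22847777 * int n^3
        - 35069178 * int n^2 - 29331496 * int n - 10279296) * y (n + 2)
    + (21560 * int n^7 + 413637 * int n^6 + 3343917 * int n^5 + 14735333 * int n^4 + 38132651 * int n^3
        + 57777574 * int n^2 + 47273504 * int n + 16026528) * y (n + 3)
    - (int n + 4) * (4410 * int n^6 + 70147 * int n^5 + 452903 * int n^4 + 1516515 * int n^3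
        + 2769127 * int n^2 + 2601986 * int n + 975888) * y (n + 4)
    + (int n + 5) * (int n + 4) * (int n + 3)
        * (245 * int n^4 + 2114 * int n^3 + 6635 * int n^2 + 8882 * int n + 4224) * y (n + 5)"

text \<open>The coefficients of \<open>rec_op\<close> add up to \<open>0\<close>, so it annihilates constants.\<close>

lemma rec_op_affine: "rec_op (\<lambda>m. 4 * y m + 1) n = 4 * rec_op y n"
  unfolding rec_op_def by algebra

text \<open>
  The multipliers in the proof are the quotients of two right divisions of operators: the part of
  \<open>rec_op\<close> that acts on \<open>a\<close> by the operator for \<open>a\<close>, and then what has accumulated on \<open>f\<close> by the operator
  for \<open>f\<close>. Both divisions are exact. The quotients have the denominators \<open>n + 3\<close>, \<open>n + 4\<close> and \<open>n + 5\<close>,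
  which the first factor clears.
\<close>

lemma rec_op_elimination:
  fixes a f :: "nat \<Rightarrow> int"
  assumes a: "\<And>m. 3 * (int m + 2) * ((int m + 2) * a (m + 2) - 5 * (2 * int m + 3) * a (m + 1)
      + 9 * (int m + 1) * a m)
    = 2 * (int m + 1) * (11 * int m + 14) * f m - 2 * (4 * int m^2 + 17 * int m + 16) * f (m + 1)"
  assumes f: "\<And>m. (int m + 2)^2 * f (m + 2)
    = (7 * int m^2 + 21 * int m + 16) * f (m + 1) + 8 * (int m + 1)^2 * f m"
  shows "rec_op (\<lambda>m. 3 * a m - 2 * f m) n = 0"
proof -
  define N where "N = int n"
  define A where "A M a0 a1 a2 f0 f1 =
    3 * (M + 2) * ((M + 2) * a2 - 5 * (2 * M + 3) * a1 + 9 * (M + 1) * a0)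
    - (2 * (M + 1) * (11 * M + 14) * f0 - 2 * (4 * M^2 + 17 * M + 16) * f1)"
    for M a0 a1 a2 f0 f1 :: int
  define F where "F M f0 f1 f2 =
    (M + 2)^2 * f2 - ((7 * M^2 + 21 * M + 16) * f1 + 8 * (M + 1)^2 * f0)"
    for M f0 f1 f2 :: int
  have A0: "A (int m) (a m) (a (m + 1)) (a (m + 2)) (f m) (f (m + 1)) = 0" for m
    using a[of m] by (simp add: A_def)
  have F0: "F (int m) (f m) (f (m + 1)) (f (m + 2)) = 0" for m
    using f[of m] by (simp add: F_def)
  have zero:
    "A N (a n) (a (n + 1)) (a (n + 2)) (f n) (f (n + 1)) = 0"
    "A (N + 1) (a (n + 1)) (a (n + 2)) (a (n + 3)) (f (n + 1)) (f (n + 2)) = 0"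
    "A (N + 2) (a (n + 2)) (a (n + 3)) (a (n + 4)) (f (n + 2)) (f (n + 3)) = 0"
    "A (N + 3) (a (n + 3)) (a (n + 4)) (a (n + 5)) (f (n + 3)) (f (n + 4)) = 0"
    "F N (f n) (f (n + 1)) (f (n + 2)) = 0"
    "F (N + 1) (f (n + 1)) (f (n + 2)) (f (n + 3)) = 0"
    "F (N + 2) (f (n + 2)) (f (n + 3)) (f (n + 4)) = 0"
    "F (N + 3) (f (n + 3)) (f (n + 4)) (f (n + 5)) = 0"
    using A0[of n] A0[of "n + 1"] A0[of "n + 2"] A0[of "n + 3"]
      F0[of n] F0[of "n + 1"] F0[of "n + 2"] F0[of "n + 3"]
    by (simp_all add: N_def numeral_eq_Suc add.commute add.left_commute)
  \<comment> \<open>The name \<open>y\<close> turns a large polynomial identity into a reduction modulo one linear hypothesis.\<close>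
  have "(N + 3) * (N + 4) * (N + 5) * rec_op (\<lambda>m. 3 * a m - 2 * f m) n = y" if "y =
      (N + 3) * (N + 4) * (N + 5) * (1960 * N^5 + 26712 * N^4 + 140328 * N^3 + 351368 * N^2 + 412592 * N + 176800)
          * A N (a n) (a (n + 1)) (a (n + 2)) (f n) (f (n + 1))
      + (N + 3) * (N + 4) * (N + 5) * (- 980 * N^5 - 10416 * N^4 - 33036 * N^3 - 2320 * N^2 + 147392 * N + 176800)
          * F N (f n) (f (n + 1)) (f (n + 2))
      + (N + 4) * (N + 5) * (- 245 * N^6 - 3829 * N^5 - 23197 * N^4 - 68039 * N^3 - 96334 * N^2 - 52020 * N + 1360)
          * A (N + 1) (a (n + 1)) (a (n + 2)) (a (n + 3)) (f (n + 1)) (f (n + 2))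
      + (N + 4) * (N + 5) * (- 1960 * N^6 - 33572 * N^5 - 235556 * N^4 - 862180 * N^3 - 1725380 * N^2 - 1776232 * N - 728960)
          * F (N + 1) (f (n + 1)) (f (n + 2)) (f (n + 3))
      + (N + 3) * (N + 5) * (- 1960 * N^6 - 30632 * N^5 - 194928 * N^4 - 644680 * N^3 - 1165012 * N^2 - 1086116 * N - 405648)
          * A (N + 2) (a (n + 2)) (a (n + 3)) (a (n + 4)) (f (n + 2)) (f (n + 3))
      + (N + 3) * (N + 5) * (3430 * N^6 + 53606 * N^5 + 341110 * N^4 + 1127970 * N^3 + 2037988 * N^2 + 1899928 * N + 709920)
          * F (N + 2) (f (n + 2)) (f (n + 3)) (f (n + 4))
      + (N + 3) * (N + 4) * (245 * N^6 + 3829 * N^5 + 24373 * N^4 + 80695 * N^3 + 146018 * N^2 + 136152 * N + 50688)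
          * A (N + 3) (a (n + 3)) (a (n + 4)) (a (n + 5)) (f (n + 3)) (f (n + 4))
      + (N + 3) * (N + 4) * (- 490 * N^6 - 7658 * N^5 - 48746 * N^4 - 161390 * N^3 - 292036 * N^2 - 272304 * N - 101376)
          * F (N + 3) (f (n + 3)) (f (n + 4)) (f (n + 5))" for y
    using that unfolding rec_op_def A_def F_def N_def[symmetric] by algebra
  hence "(N + 3) * (N + 4) * (N + 5) * rec_op (\<lambda>m. 3 * a m - 2 * f m) n = 0"
    by (simp only: zero)
  thus ?thesis by (simp add: N_def)
qed

theorem proposition2:
  shows "(\<forall>n::nat. n \<ge> 1 \<longrightarrow>
      72 * (int n + 2) * (245 * int n^4 + 3094 * int n^3 + 14447 * int n^2 + 29474 * int n + 22100) * (int n + 1)^2 * C3 n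
    - (int n + 2) * (21805 * int n^6 + 330981 * int n^5 + 2012733 * int n^4 + 6230951 * int n^3
        + 10263446 * int n^2 + 8425060 * int n + 2639760) * C3 (n + 1)
    + (- 13230 * int n^7 - 249641 * int n^6 - 1998705 * int n^5 - 8785333 * int n^4 - 22847777 * int n^3
        - 35069178 * int n^2 - 29331496 * int n - 10279296) * C3 (n + 2)
    + (21560 * int n^7 + 413637 * int n^6 + 3343917 * int n^5 + 14735333 * int n^4 + 38132651 * int n^3
        + 57777574 * int n^2 + 47273504 * int n + 16026528) * C3 (n + 3)
    - (int n + 4) * (4410 * int n^6 + 70147 * int n^5 + 452903 * int n^4 + 1516515 * int n^3
        + 2769127 * int n^2 + 2601986 * int n + 975888) * C3 (n + 4)
    + (int n + 5) * (int n + 4) * (int n + 3)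
        * (245 * int n^4 + 2114 * int n^3 + 6635 * int n^2 + 8882 * int n + 4224) * C3 (n + 5) = 0)
    \<and> C3 1 = 1 \<and> C3 2 = 6 \<and> C3 3 = 37 \<and> C3 4 = 240 \<and> C3 5 = 1621"
proof (intro conjI allI impI)
  fix n :: nat
  have "4 * rec_op C3 n = rec_op (\<lambda>m. 3 * diag_line m - 2 * franel m) n"
    by (simp only: rec_op_affine[symmetric] C3_eq_diag_line)
  also have "\<dots> = 0"
    by (rule rec_op_elimination) (rule diag_line_recurrence, rule franel_recurrence)
  finally show "72 * (int n + 2) * (245 * int n^4 + 3094 * int n^3 + 14447 * int n^2 + 29474 * int n + 22100) * (int n + 1)^2 * C3 n
    - (int n + 2) * (21805 * int n^6 + 330981 * int n^5 + 2012733 * int n^4 + 6230951 * int n^3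
        + 10263446 * int n^2 + 8425060 * int n + 2639760) * C3 (n + 1)
    + (- 13230 * int n^7 - 249641 * int n^6 - 1998705 * int n^5 - 8785333 * int n^4 - 22847777 * int n^3
        - 35069178 * int n^2 - 29331496 * int n - 10279296) * C3 (n + 2)
    + (21560 * int n^7 + 413637 * int n^6 + 3343917 * int n^5 + 14735333 * int n^4 + 38132651 * int n^3
        + 57777574 * int n^2 + 47273504 * int n + 16026528) * C3 (n + 3)
    - (int n + 4) * (4410 * int n^6 + 70147 * int n^5 + 452903 * int n^4 + 1516515 * int n^3
        + 2769127 * int n^2 + 2601986 * int n + 975888) * C3 (n + 4)
    + (int n + 5) * (int n + 4) * (int n + 3)
        * (245 * int n^4 + 2114 * int n^3 + 6635 * int n^2 + 8882 * int n + 4224) * C3 (n + 5) = 0"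
    by (simp add: rec_op_def)
next
  show "C3 1 = 1" "C3 2 = 6" "C3 3 = 37" "C3 4 = 240" "C3 5 = 1621"
    by (simp_all add: C3_eq_box_sum box_sum_def square_sum_def line_sum_def numeral_eq_Suc)
qed

end
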